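(* Let $d\ge 1$, let $f:\mathbb{T}^d\to\mathbb{T}^d$ be a homeomorphism homotopic to the identity, and let $K\subseteq\mathbb{T}^d$ be a minimal set of $f$. Suppose that $f$ is an irrational pseudo-rotation with bounded mean motion on $K$, with totally irrational rotation vector $\rho\in\mathbb{R}^d$ (with respect to a lift $F$ of $f$). Then $f_{|K}$ is regularly semi-conjugate to the irrational rotation $R_\rho:z\mapsto z+\rho \bmod 1$ on $\mathbb{T}^d$.
   Context: $\mathbb{T}^d=\mathbb{R}^d/\mathbb{Z}^d$ and $\pi:\mathbb{R}^d\to\mathbb{T}^d$ is the quotient map. A vector $\rho\in\mathbb{R}^d$ is totally irrational if $1,\rho_1,\dots,\rho_d$ are linearly independent over $\mathbb{Q}$ (equivalently, $R_\rho$ is minimal on $\mathbb{T}^d$). A minimal set of $f$ is a non-empty closed $f$-invariant set containing no strictly smaller non-empty closed $f$-invariant set. For an $f$-invariant set $K\subseteq\mathbb{T}^d$, $f$ is an irrational pseudo-rotation on $K$ if there are a totally irrational vector $\rho\in\mathbb{R}^d$ and a lift $F:\mathbb{R}^d\to\mathbb{R}^d$ of $f$ such that $\lim_{n\to\infty}(F^n(z)-z)/n=\rho$ for all $z\in\pi^{-1}(K)$. It has bounded mean motion on $K$ if there is a constant $c\ge 0$ such that $\|F^n(z)-z-n\rho\|\le c$ for all $n\in\mathbb{Z}$ and all $z\in\pi^{-1}(K)$. A semi-conjugacy from $\varphi:X\to X$ to $\psi:Y\to Y$ is a continuous surjective map $h:X\to Y$ with $h\circ\varphi=\psi\circ h$.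 A semi-conjugacy $h:K\to\mathbb{T}^d$ from $f_{|K}$ to $R_\rho$ is called regular if it has a lift $H:\pi^{-1}(K)\to\mathbb{R}^d$ (i.e. $\pi\circ H=h\circ\pi$, $H$ continuous) that semi-conjugates $F_{|\pi^{-1}(K)}$ to the translation $z\mapsto z+\rho$, i.e. $H\circ F=H+\rho$ on $\pi^{-1}(K)$, and that satisfies $\sup_{z\in\pi^{-1}(K)}\|H(z)-z\|<\infty$. "Regularly semi-conjugate" means that a regular semi-conjugacy exists. *)

theory Defs
  imports "HOL-Analysis.Analysis"
begin

text \<open>The dimension \<open>d\<close> is \<open>CARD('n)\<close> for a finite index type \<open>'n\<close>; hence \<open>d \<ge> 1\<close> automatically.\<close>

definition integer_vectors :: "(real ^ 'n::finite) set" where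
  "integer_vectors = {k. \<forall>i. k $ i \<in> \<int>}"

definition torus_rel :: "real ^ 'n::finite \<Rightarrow> real ^ 'n \<Rightarrow> bool" where
  "torus_rel x y \<longleftrightarrow> x - y \<in> integer_vectors"

lemma equivp_torus_rel: "equivp torus_rel"
proof (rule equivpI)
  show "reflp torus_rel"
    by (auto simp: reflp_def torus_rel_def integer_vectors_def)
  show "symp torus_rel"
    unfolding symp_def torus_rel_def integer_vectors_def
  proof (clarsimp)
    fix x y :: "real ^ 'n" and i
    assume "\<forall>i. x $ i - y $ i \<in> \<int>"
    then have "- (x $ i - y $ i) \<in> \<int>" by (blast intro: Ints_minus)
    then show "y $ i - x $ i \<in> \<int>" by simp
  qed
  show "transp torus_rel"
    unfolding transp_def torus_rel_def integer_vectors_def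
  proof (clarsimp)
    fix x y z :: "real ^ 'n" and i
    assume "\<forall>i. x $ i - y $ i \<in> \<int>" "\<forall>i. y $ i - z $ i \<in> \<int>"
    then have "(x $ i - y $ i) + (y $ i - z $ i) \<in> \<int>" by (blast intro: Ints_add)
    then show "x $ i - z $ i \<in> \<int>" by simp
  qed
qed

quotient_type (overloaded) 'n torus = "real ^ 'n::finite" / torus_rel
  by (rule equivp_torus_rel)

lift_definition torus_proj :: "real ^ 'n::finite \<Rightarrow> 'n torus" is "\<lambda>x. x" .

lift_definition rotation :: "real ^ 'n::finite \<Rightarrow> 'n torus \<Rightarrow> 'n torus" is "\<lambda>\<rho> x. x + \<rho>"
  by (simp add: torus_rel_def)

text \<open>The torus carries the quotient topology.\<close>

instantiation torus :: (finite) topological_space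
begin

definition open_torus :: "'a torus set \<Rightarrow> bool" where
  "open_torus U \<longleftrightarrow> open (torus_proj -` U)"

instance
proof
  show "open (UNIV :: 'a torus set)"
    by (simp add: open_torus_def)
next
  fix S T :: "'a torus set"
  assume "open S" "open T"
  then show "open (S \<inter> T)"
    by (simp add: open_torus_def vimage_Int open_Int)
next
  fix \<K> :: "'a torus set set"
  assume "\<forall>S\<in>\<K>. open S"
  then show "open (\<Union>\<K>)"
    by (auto simp: open_torus_def vimage_Union)
qed

end

definition totally_irrational :: "real ^ 'n::finite \<Rightarrow> bool" where
  "totally_irrational \<rho> \<longleftrightarrow>
     (\<forall>(q0::rat) (q::'n \<Rightarrow> rat).
        of_rat q0 * 1 + (\<Sum>i\<in>UNIV. of_rat (q i) * \<rho> $ i) = 0 \<longrightarrow> q0 = 0 \<and> (\<forall>i. q i = 0))"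

definition invariant_set :: "('a \<Rightarrow> 'a) \<Rightarrow> 'a set \<Rightarrow> bool" where
  "invariant_set f K \<longleftrightarrow> f ` K = K"

definition minimal_set :: "('a::topological_space \<Rightarrow> 'a) \<Rightarrow> 'a set \<Rightarrow> bool" where
  "minimal_set f K \<longleftrightarrow>
     K \<noteq> {} \<and> closed K \<and> invariant_set f K \<and>
     (\<forall>L. L \<subseteq> K \<and> L \<noteq> {} \<and> closed L \<and> invariant_set f L \<longrightarrow> L = K)"

definition is_lift :: "(real ^ 'n::finite \<Rightarrow> real ^ 'n) \<Rightarrow> ('n torus \<Rightarrow> 'n torus) \<Rightarrow> bool" where
  "is_lift F f \<longleftrightarrow> continuous_on UNIV F \<and> torus_proj \<circ> F = f \<circ> torus_proj"

text \<open>Integer iterates. Negative ones are meaningful only for bijective maps; any lift of a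
  torus homeomorphism homotopic to the identity is bijective.\<close>

definition iter :: "('a \<Rightarrow> 'a) \<Rightarrow> int \<Rightarrow> 'a \<Rightarrow> 'a" where
  "iter F n = (if n \<ge> 0 then F ^^ nat n else (inv F) ^^ nat (- n))"

definition irrational_pseudo_rotation_on ::
  "('n::finite torus \<Rightarrow> 'n torus) \<Rightarrow> 'n torus set \<Rightarrow>
   (real ^ 'n \<Rightarrow> real ^ 'n) \<Rightarrow> real ^ 'n \<Rightarrow> bool" where
  "irrational_pseudo_rotation_on f K F \<rho> \<longleftrightarrow>
     invariant_set f K \<and> totally_irrational \<rho> \<and> is_lift F f \<and>
     (\<forall>z \<in> torus_proj -` K. (\<lambda>n. ((F ^^ n) z - z) /\<^sub>R real n) \<longlonglongrightarrow> \<rho>)"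

definition bounded_mean_motion_on ::
  "'n::finite torus set \<Rightarrow> (real ^ 'n \<Rightarrow> real ^ 'n) \<Rightarrow> real ^ 'n \<Rightarrow> bool" where
  "bounded_mean_motion_on K F \<rho> \<longleftrightarrow>
     (\<exists>c\<ge>0. \<forall>n::int. \<forall>z \<in> torus_proj -` K. norm (iter F n z - z - of_int n *\<^sub>R \<rho>) \<le> c)"

definition semiconjugacy ::
  "'a::topological_space set \<Rightarrow> ('a \<Rightarrow> 'a) \<Rightarrow>
   'b::topological_space set \<Rightarrow> ('b \<Rightarrow> 'b) \<Rightarrow> ('a \<Rightarrow> 'b) \<Rightarrow> bool" where
  "semiconjugacy X \<phi> Y \<psi> h \<longleftrightarrow>
     continuous_on X h \<and> h ` X = Y \<and> (\<forall>x\<in>X. h (\<phi> x) = \<psi> (h x))"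

definition regular_semiconjugacy ::
  "('n::finite torus \<Rightarrow> 'n torus) \<Rightarrow> 'n torus set \<Rightarrow>
   (real ^ 'n \<Rightarrow> real ^ 'n) \<Rightarrow> real ^ 'n \<Rightarrow> ('n torus \<Rightarrow> 'n torus) \<Rightarrow> bool" where
  "regular_semiconjugacy f K F \<rho> h \<longleftrightarrow>
     semiconjugacy K f UNIV (rotation \<rho>) h \<and>
     (\<exists>H. continuous_on (torus_proj -` K) H \<and>
          (\<forall>z \<in> torus_proj -` K. torus_proj (H z) = h (torus_proj z)) \<and>
          (\<forall>z \<in> torus_proj -` K. H (F z) = H z + \<rho>) \<and>
          bdd_above ((\<lambda>z. norm (H z - z)) ` (torus_proj -` K)))"

definition regularly_semiconjugate ::
  "('n::finite torus \<Rightarrow> 'n torus) \<Rightarrow> 'n torus set \<Rightarrow>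
   (real ^ 'n \<Rightarrow> real ^ 'n) \<Rightarrow> real ^ 'n \<Rightarrow> bool" where
  "regularly_semiconjugate f K F \<rho> \<longleftrightarrow> (\<exists>h. regular_semiconjugacy f K F \<rho> h)"

end

theory Submission
  imports Defs
begin

text \<open>
  The semi-conjugacy is \<open>H z $ i = (SUP n. (F\<^sup>n z - n \<rho>) $ i)\<close>, the supremum being taken over all
  integers, so that \<open>H \<circ> F = H + \<rho>\<close> holds exactly. The oscillation of \<open>(F\<^sup>n z - n \<rho>) $ i\<close> over \<open>n\<close>
  is lower semicontinuous and invariant, hence constant on the minimal set; thus the supremum and
  the infimum differ by a constant, and the lower semicontinuous supremum is also upper
  semicontinuous. Surjectivity follows from Kronecker's theorem, since the range of \<open>H\<close> is closed
  and invariant under translation by \<open>\<rho>\<close> and by integer vectors.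
\<close>

section \<open>The torus as a quotient by integer vectors\<close>

lemma torus_proj_eq_iff: "torus_proj x = torus_proj y \<longleftrightarrow> x - y \<in> integer_vectors"
  by transfer (simp add: torus_rel_def)

lemma surj_torus_proj: "\<exists>z. torus_proj z = x"
  by transfer (use equivp_reflp[OF equivp_torus_rel] in blast)

lemma rotation_torus_proj: "rotation \<rho> (torus_proj z) = torus_proj (z + \<rho>)"
  by transfer (simp add: torus_rel_def integer_vectors_def)

lemma closed_torus_iff: "closed S \<longleftrightarrow> closed (torus_proj -` S)"
  by (simp add: closed_def open_torus_def vimage_Compl)

lemma minus_in_integer_vectors: "k \<in> integer_vectors \<Longrightarrow> - k \<in> integer_vectors"
  by (simp add: integer_vectors_def)

lemma torus_proj_add_integer: "k \<in> integer_vectors \<Longrightarrow> torus_proj (z + k) = torus_proj z"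
  by (simp add: torus_proj_eq_iff)

section \<open>Lifts of torus homeomorphisms and their integer iterates\<close>

lemma continuous_integer_vector_valued_constant:
  fixes g :: "real ^ 'n::finite \<Rightarrow> real ^ 'n"
  assumes cont: "continuous_on UNIV g" and int: "\<And>z. g z \<in> integer_vectors"
  shows "g z = g w"
proof (rule vec_eq_iff[THEN iffD2], rule allI)
  fix i
  have "(\<lambda>z. g z $ i) constant_on UNIV"
  proof (rule continuous_discrete_range_constant)
    show "continuous_on UNIV (\<lambda>z. g z $ i)"
      by (intro continuous_intros cont)
    fix x :: "real ^ 'n"
    \<comment> \<open>Distinct integers are at distance at least 1, so each coordinate has discrete
      range on a connected domain.\<close>
    have "1 \<le> norm (g y $ i - g x $ i)" if "g y $ i \<noteq> g x $ i" for y
    proof -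
      have "g y $ i - g x $ i \<in> \<int>"
        using int[of x] int[of y] by (simp add: integer_vectors_def)
      then show ?thesis
        using that Ints_nonzero_abs_ge1[of "g y $ i - g x $ i"] by simp
    qed
    then show "\<exists>e>0. \<forall>y. y \<in> UNIV \<and> g y $ i \<noteq> g x $ i \<longrightarrow> e \<le> norm (g y $ i - g x $ i)"
      by (intro exI[of _ 1]) auto
  qed (rule connected_UNIV)
  then show "g z $ i = g w $ i"
    by (auto simp: constant_on_def)
qed

text \<open>\<open>F (z + k)\<close> and \<open>F z\<close> lie over the same point of the torus, so
  their difference is an integer vector depending continuously on \<open>z\<close>.\<close>

lemma lift_translation_constant:
  assumes lift: "is_lift F f" and k: "k \<in> integer_vectors"
  shows "F (z + k) - F z = F (w + k) - F w"
proof -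
  have pF: "torus_proj (F z) = f (torus_proj z)" for z
    using lift by (auto simp: is_lift_def fun_eq_iff)
  have int: "F (z + k) - F z \<in> integer_vectors" for z
    by (simp add: torus_proj_eq_iff[symmetric] pF torus_proj_add_integer[OF k])
  have F: "continuous_on UNIV F"
    using lift by (simp add: is_lift_def)
  have "continuous_on UNIV (\<lambda>z. F (z + k) - F z)"
    by (intro continuous_intros F continuous_on_compose2[OF F]) auto
  from continuous_integer_vector_valued_constant[OF this int]
  show "F (z + k) - F z = F (w + k) - F w" .
qed

text \<open>Bounded mean motion already forces the lift to commute with integer translations: the
  action of \<open>F\<close> on \<open>\<int>\<^sup>d\<close> is a homomorphism at bounded distance from the identity.\<close>

lemma lift_commutes:
  assumes lift: "is_lift F f"
    and bound: "\<And>z. torus_proj z \<in> K \<Longrightarrow> norm (F z - z - \<rho>) \<le> c"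
    and "K \<noteq> {}" and k: "k \<in> integer_vectors"
  shows "F (z + k) = F z + k"
proof -
  obtain w where w: "torus_proj w \<in> K"
    using \<open>K \<noteq> {}\<close> surj_torus_proj by (metis ex_in_conv)
  define a where "a = F (w + k) - F w"
  have a: "F (z + k) = F z + a" for z
    using lift_translation_constant[OF lift k, of z w] by (simp add: a_def algebra_simps)
  have mk: "real m *\<^sub>R k \<in> integer_vectors" for m
    using k by (auto simp: integer_vectors_def)
  have am: "F (w + real m *\<^sub>R k) = F w + real m *\<^sub>R a" for m
  proof (induction m)
    case (Suc m)
    have "F (w + real (Suc m) *\<^sub>R k) = F ((w + real m *\<^sub>R k) + k)"
      by (simp add: algebra_simps)
    then show ?case
      by (simp only: a Suc) (simp add: algebra_simps)
  qed simp
  \<comment> \<open>The displacements of \<open>F\<close> at \<open>w + m k\<close> and at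
    \<open>w\<close> differ by \<open>m (a - k)\<close>, while both are within \<open>c\<close> of
    \<open>\<rho>\<close>. As \<open>m\<close> is arbitrary, \<open>a = k\<close>.\<close>
  have "real m * norm (a - k) \<le> 2 * c" for m
  proof -
    let ?w = "w + real m *\<^sub>R k"
    have "real m *\<^sub>R (a - k) = (F ?w - ?w - \<rho>) - (F w - w - \<rho>)"
      by (simp add: am algebra_simps)
    then have "real m * norm (a - k) = norm ((F ?w - ?w - \<rho>) - (F w - w - \<rho>))"
      by (metis abs_of_nat norm_scaleR)
    also have "\<dots> \<le> c + c"
      using w by (intro order_trans[OF norm_triangle_ineq4] add_mono bound)
        (simp_all add: torus_proj_add_integer mk)
    finally show ?thesis by simp
  qed
  then have "norm (a - k) = 0"
    using reals_Archimedean3[of "norm (a - k)"] by (metis not_less zero_less_norm_iff norm_eq_zero)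
  then show ?thesis
    by (simp add: a)
qed

text \<open>Since \<open>f\<close> is injective, two points with the same image under
  \<open>F\<close> differ by an integer vector, and commutation forces that vector to be 0. Since
  \<open>f\<close> is surjective, every point is hit up to an integer vector, which commutation
  absorbs into the argument.\<close>

lemma bij_lift:
  assumes lift: "is_lift F f" and "bij f"
    and comm: "\<And>z k. k \<in> integer_vectors \<Longrightarrow> F (z + k) = F z + k"
  shows "bij F"
proof -
  have pF: "torus_proj (F z) = f (torus_proj z)" for z
    using lift by (auto simp: is_lift_def fun_eq_iff)
  show ?thesis
  proof (rule bijI)
    show "inj F"
    proof (rule injI)
      fix x y assume eq: "F x = F y"
      then have "f (torus_proj x) = f (torus_proj y)"
        using pF by metis
      then have "x - y \<in> integer_vectors"
        using \<open>bij f\<close> by (simp add: bij_def inj_eq torus_proj_eq_iff)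
      from comm[OF this, of y] eq show "x = y" by simp
    qed
    show "surj F"
    proof (rule surjI)
      fix w
      have "\<exists>z. torus_proj (F z) = torus_proj w"
        unfolding pF by (metis \<open>bij f\<close> bij_pointE surj_torus_proj)
      then obtain z where "F z - w \<in> integer_vectors"
        by (auto simp: torus_proj_eq_iff)
      from comm[OF minus_in_integer_vectors[OF this], of z] have "\<exists>z. F z = w"
        by (metis add.commute diff_add_cancel uminus_add_conv_diff minus_diff_eq)
      then show "F (SOME z. F z = w) = w"
        by (rule someI_ex)
    qed
  qed
qed

text \<open>This is invariance of domain; it makes the negative iterates continuous.\<close>

lemma continuous_on_inv_lift:
  fixes F :: "'a::euclidean_space \<Rightarrow> 'a"
  assumes "continuous_on UNIV F" "bij F"
  shows "continuous_on UNIV (inv F)"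
  using continuous_on_inverse_open[of UNIV F "inv F"] assms by (simp add: bij_def)

lemma continuous_on_funpow:
  fixes F :: "'a::topological_space \<Rightarrow> 'a"
  shows "continuous_on UNIV F \<Longrightarrow> continuous_on UNIV (F ^^ n)"
  by (induction n) (auto simp: id_def[symmetric] intro: continuous_on_compose2)

lemma continuous_on_iter:
  fixes F :: "'a::euclidean_space \<Rightarrow> 'a"
  assumes "continuous_on UNIV F" "bij F"
  shows "continuous_on UNIV (iter F n)"
  using assms by (simp add: iter_def[abs_def] continuous_on_funpow continuous_on_inv_lift)

lemma iter_shift:
  assumes "bij F"
  shows "iter F n (F z) = iter F (n + 1) z"
proof (cases "n \<ge> 0")
  case True
  then show ?thesis
    by (simp add: iter_def nat_add_distrib funpow_swap1)
next
  case False
  \<comment> \<open>One of the \<open>m + 1\<close> backward steps cancels against \<open>F\<close>.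
    For \<open>n = -1\<close> the index \<open>n + 1\<close> is 0, so \<open>iter\<close> switches
    to its forward branch and \<open>m = 0\<close>.\<close>
  define m where "m = nat (- n - 1)"
  with False have "nat (- n) = Suc m" "nat (- (n + 1)) = m" "n + 1 \<ge> 0 \<longleftrightarrow> m = 0" "n + 1 \<ge> 0 \<Longrightarrow> n + 1 = 0"
    by linarith+
  with False show ?thesis
    using assms by (auto simp: iter_def funpow_Suc_right bij_is_inj simp del: funpow.simps(2))
qed

lemma funpow_add_commutes:
  fixes F :: "'a::plus \<Rightarrow> 'a"
  assumes "\<And>z. F (z + k) = F z + k"
  shows "(F ^^ n) (z + k) = (F ^^ n) z + k"
  by (induction n) (simp_all add: assms)

lemma iter_add_commutes:
  fixes F :: "'a::plus \<Rightarrow> 'a"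
  assumes "bij F" "\<And>z. F (z + k) = F z + k"
  shows "iter F n (z + k) = iter F n z + k"
proof -
  have "inv F (w + k) = inv F w + k" for w
    by (metis assms bij_inv_eq_iff)
  then show ?thesis
    by (simp add: iter_def funpow_add_commutes assms(2))
qed

lemma lift_image_preimage:
  assumes lift: "is_lift F f" and "bij f" and "bij F" and K: "f ` K = K"
  shows "F ` (torus_proj -` K) = torus_proj -` K"
proof -
  have pF: "torus_proj (F z) = f (torus_proj z)" for z
    using lift by (auto simp: is_lift_def fun_eq_iff)
  have iff: "torus_proj (F z) \<in> K \<longleftrightarrow> torus_proj z \<in> K" for z
    unfolding pF using K \<open>bij f\<close> by (metis bij_is_inj inj_image_mem_iff)
  show ?thesis
  proof (intro equalityI subsetI)
    fix w assume "w \<in> torus_proj -` K"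
    moreover obtain z where "w = F z"
      using \<open>bij F\<close> by (auto elim: bij_pointE)
    ultimately show "w \<in> F ` (torus_proj -` K)"
      using iff by simp
  qed (auto simp: iff)
qed

text \<open>Transfers minimality to the cover. A periodic set \<open>L\<close> is the full preimage
  of its projection, so that projection is closed in the quotient topology, and it is invariant
  because \<open>F\<close> covers \<open>f\<close>.\<close>

lemma minimal_set_lift:
  assumes min: "minimal_set f K" and lift: "is_lift F f"
    and L: "L \<subseteq> torus_proj -` K" "L \<noteq> {}" "closed L" "F ` L = L"
    and per: "\<And>z k. z \<in> L \<Longrightarrow> k \<in> integer_vectors \<Longrightarrow> z + k \<in> L"
  shows "L = torus_proj -` K"
proof -
  have pF: "torus_proj (F z) = f (torus_proj z)" for z
    using lift by (auto simp: is_lift_def fun_eq_iff)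
  have pre: "torus_proj -` (torus_proj ` L) = L"
  proof (intro equalityI subsetI)
    fix z assume "z \<in> torus_proj -` torus_proj ` L"
    then obtain w where "w \<in> L" "z - w \<in> integer_vectors"
      by (auto simp: torus_proj_eq_iff)
    then show "z \<in> L"
      using per[of w "z - w"] by simp
  qed auto
  have "f ` torus_proj ` L = torus_proj ` F ` L"
    by (simp add: image_image pF)
  then have "torus_proj ` L = K"
  proof -
    have "torus_proj ` L \<subseteq> K" "torus_proj ` L \<noteq> {}"
      using L(1,2) by auto
    moreover have "closed (torus_proj ` L)"
      by (simp only: closed_torus_iff pre L(3))
    ultimately show ?thesis
      using min \<open>f ` torus_proj ` L = torus_proj ` F ` L\<close> L(4)
      unfolding minimal_set_def invariant_set_def by metis
  qed
  with pre show ?thesis by simp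
qed

section \<open>Continuity of suprema with constant oscillation\<close>

text \<open>A supremum of continuous functions is lower semicontinuous and an infimum is upper
  semicontinuous. Here they differ by the constant \<open>C\<close>, so the supremum has both
  properties.\<close>

lemma continuous_on_SUP_constant_oscillation:
  fixes p :: "'i \<Rightarrow> 'a::topological_space \<Rightarrow> real"
  assumes cont: "\<And>n. continuous_on S (p n)"
    and bdd: "\<And>z. z \<in> S \<Longrightarrow> bdd_above (range (\<lambda>n. p n z))"
      "\<And>z. z \<in> S \<Longrightarrow> bdd_below (range (\<lambda>n. p n z))"
    and osc: "\<And>z. z \<in> S \<Longrightarrow> (SUP n. p n z) = C + (INF n. p n z)"
  shows "continuous_on S (\<lambda>z. SUP n. p n z)"
  unfolding continuous_on_def
proof (intro ballI order_tendstoI)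
  fix z a assume z: "z \<in> S"
  have S: "\<forall>\<^sub>F w in at z within S. w \<in> S"
    by (simp add: eventually_at_filter)
  have lim: "(p n \<longlongrightarrow> p n z) (at z within S)" for n
    using cont z by (auto simp: continuous_on_def)
  {
    assume "a < (SUP n. p n z)"
    then obtain n where "a < p n z"
      using less_cSUP_iff[OF _ bdd(1)[OF z]] by auto
    with lim have "\<forall>\<^sub>F w in at z within S. a < p n w"
      by (rule order_tendstoD)
    with S show "\<forall>\<^sub>F w in at z within S. a < (SUP n. p n w)"
    proof eventually_elim
      case (elim w)
      then show ?case
        using cSUP_upper[OF UNIV_I bdd(1), of w n] by simp
    qed
  next
    assume "(SUP n. p n z) < a"
    then have "(INF n. p n z) < a - C"
      using osc[OF z] by simp
    then obtain n where "p n z < a - C"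
      using cINF_less_iff[OF _ bdd(2)[OF z]] by auto
    with lim have "\<forall>\<^sub>F w in at z within S. p n w < a - C"
      by (rule order_tendstoD)
    with S show "\<forall>\<^sub>F w in at z within S. (SUP n. p n w) < a"
    proof eventually_elim
      case (elim w)
      then have "(INF n. p n w) < a - C"
        using cINF_lower[OF bdd(2) UNIV_I, of w n] by simp
      then show ?case
        using osc elim(1) by simp
    qed
  }
qed

section \<open>Kronecker approximation for totally irrational vectors\<close>

text \<open>Puts total irrationality into the form that \<open>Kronecker_thm_2\<close> expects: a
  family indexed by naturals, independent over the integers, with the entry 1 at the last index. An
  integer relation among the \<open>\<theta> i\<close> is a rational relation among 1 and the
  coordinates of \<open>\<rho>\<close>.\<close>

lemma independent_totally_irrational:
  fixes \<rho> :: "real ^ 'n::finite"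
  assumes irr: "totally_irrational \<rho>" and e: "bij_betw e {..<CARD('n)} (UNIV :: 'n set)"
  defines "\<theta> \<equiv> \<lambda>i. if i < CARD('n) then \<rho> $ e i else 1"
  shows "module.independent (\<lambda>r x. real_of_int r * x) (\<theta> ` {..CARD('n)})"
    and "inj_on \<theta> {..CARD('n)}"
proof -
  let ?d = "CARD('n)"
  interpret Modules.module "\<lambda>r x. real_of_int r * x"
    by (simp add: Modules.module.intro distrib_left mult.commute)
  have split: "(\<Sum>i\<le>?d. real_of_int (c i) * \<theta> i)
      = real_of_int (c ?d) + (\<Sum>j\<in>UNIV. real_of_int (c (inv_into {..<?d} e j)) * \<rho> $ j)" for c
  proof -
    have "(\<Sum>i\<le>?d. real_of_int (c i) * \<theta> i)
        = real_of_int (c ?d) + (\<Sum>i<?d. real_of_int (c i) * \<rho> $ e i)"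
      by (simp add: lessThan_Suc_atMost[symmetric] \<theta>_def)
    also have "(\<Sum>i<?d. real_of_int (c i) * \<rho> $ e i)
        = (\<Sum>i<?d. real_of_int (c (inv_into {..<?d} e (e i))) * \<rho> $ e i)"
      using e by (intro sum.cong) (auto simp: bij_betw_inv_into_left)
    also have "\<dots> = (\<Sum>j\<in>UNIV. real_of_int (c (inv_into {..<?d} e j)) * \<rho> $ j)"
      by (rule sum.reindex_bij_betw[OF e])
    finally show ?thesis .
  qed
  have zero: "c i = 0" if "(\<Sum>i\<le>?d. real_of_int (c i) * \<theta> i) = 0" "i \<le> ?d" for c :: "nat \<Rightarrow> int" and i
  proof -
    have "of_rat (of_int (c ?d)) * 1
        + (\<Sum>j\<in>UNIV. of_rat (of_int (c (inv_into {..<?d} e j))) * \<rho> $ j) = 0"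
      using that(1) unfolding split by simp
    then have "(of_int (c ?d) :: rat) = 0 \<and> (\<forall>j. (of_int (c (inv_into {..<?d} e j)) :: rat) = 0)"
      using irr[unfolded totally_irrational_def, rule_format,
          of "of_int (c ?d)" "\<lambda>j. of_int (c (inv_into {..<?d} e j))"] by blast
    then have "c ?d = 0" "\<And>j. c (inv_into {..<?d} e j) = 0"
      by auto
    then show ?thesis
      using that(2) bij_betw_inv_into_left[OF e, of i] by (metis le_neq_implies_less lessThan_iff)
  qed
  show inj: "inj_on \<theta> {..?d}"
  proof (rule inj_onI, rule ccontr)
    fix i j assume ij: "i \<in> {..?d}" "j \<in> {..?d}" "\<theta> i = \<theta> j" "i \<noteq> j"
    \<comment> \<open>If \<open>\<theta> i = \<theta> j\<close>, these coefficients give a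
      nontrivial integer relation.\<close>
    let ?c = "\<lambda>l. (if l = i then 1 else 0) - (if l = j then 1 else 0) :: int"
    have "(\<Sum>l\<le>?d. real_of_int (?c l) * \<theta> l)
        = (\<Sum>l\<le>?d. (if l = i then \<theta> l else 0) - (if l = j then \<theta> l else 0))"
      by (intro sum.cong) auto
    also have "\<dots> = 0"
      using ij by (simp add: sum_subtractf)
    finally have "(\<Sum>l\<le>?d. real_of_int (?c l) * \<theta> l) = 0" .
    from zero[OF this, of i] ij show False by simp
  qed
  show "independent (\<theta> ` {..?d})"
  proof
    assume "dependent (\<theta> ` {..?d})"
    then obtain u where u: "\<exists>v\<in>\<theta> ` {..?d}. u v \<noteq> 0"
        "(\<Sum>v\<in>\<theta> ` {..?d}. real_of_int (u v) * v) = 0"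
      using dependent_finite[of "\<theta> ` {..?d}"] by auto
    have "(\<Sum>i\<le>?d. real_of_int (u (\<theta> i)) * \<theta> i) = 0"
      using u(2) by (simp add: sum.reindex[OF inj] o_def)
    from zero[OF this] u(1) show False by auto
  qed
qed

lemma Kronecker_totally_irrational:
  fixes \<rho> y :: "real ^ 'n::finite"
  assumes irr: "totally_irrational \<rho>" and "\<epsilon> > 0"
  obtains k :: int and m where "m \<in> integer_vectors" "norm (of_int k *\<^sub>R \<rho> + m - y) < \<epsilon>"
proof -
  let ?d = "CARD('n)"
  obtain e where e: "bij_betw e {..<?d} (UNIV :: 'n set)"
    using ex_bij_betw_nat_finite[of "UNIV :: 'n set"] by (auto simp: atLeast0LessThan)
  define \<theta> where "\<theta> = (\<lambda>i. if i < ?d then \<rho> $ e i else 1)"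
  note ind = independent_totally_irrational[OF irr e, folded \<theta>_def]
  \<comment> \<open>The coordinatewise errors are added up in the l1 norm, hence the division by the
    dimension.\<close>
  have "\<epsilon> / ?d > 0"
    using \<open>\<epsilon> > 0\<close> by simp
  then obtain k q where kq:
      "\<And>i. i < ?d \<Longrightarrow> \<bar>of_int k * \<theta> i - of_int (q i) - y $ e i\<bar> < \<epsilon> / ?d"
    using Kronecker_thm_2[OF ind, where \<epsilon> = "\<epsilon> / ?d" and \<alpha> = "\<lambda>i. y $ e i"]
    by (auto simp: \<theta>_def)
  define m :: "real ^ 'n" where "m = (\<chi> j. - of_int (q (inv_into {..<?d} e j)))"
  have "norm (of_int k *\<^sub>R \<rho> + m - y) \<le> (\<Sum>j\<in>UNIV. \<bar>(of_int k *\<^sub>R \<rho> + m - y) $ j\<bar>)"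
    by (rule norm_le_l1_cart)
  also have "\<dots> < (\<Sum>j\<in>(UNIV :: 'n set). \<epsilon> / ?d)"
  proof (rule sum_strict_mono)
    fix j :: 'n
    obtain i where i: "i < ?d" "j = e i"
      using e by (metis bij_betwE bij_betw_imp_surj_on image_iff lessThan_iff UNIV_I)
    then have "inv_into {..<?d} e j = i"
      using e by (simp add: bij_betw_inv_into_left)
    then show "\<bar>(of_int k *\<^sub>R \<rho> + m - y) $ j\<bar> < \<epsilon> / ?d"
      using kq[OF i(1)] i by (simp add: m_def \<theta>_def)
  qed auto
  also have "\<dots> = \<epsilon>"
    by simp
  finally show ?thesis
    by (intro that[of m k]) (auto simp: m_def integer_vectors_def)
qed

section \<open>Surjectivity on the cover\<close>

text \<open>Values near \<open>y\<close> come only from points in a fixed ball around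
  \<open>y\<close>, so near \<open>y\<close> the image agrees with the image of a compact
  set.\<close>

lemma closed_image_bounded_displacement:
  fixes H :: "'a::euclidean_space \<Rightarrow> 'a"
  assumes "closed S" and cont: "continuous_on S H" and B: "\<And>z. z \<in> S \<Longrightarrow> norm (H z - z) \<le> B"
  shows "closed (H ` S)"
proof -
  have "y \<in> H ` S" if y: "y \<in> closure (H ` S)" for y
  proof -
    let ?S = "S \<inter> cball y (B + 1)"
    have "compact (H ` ?S)"
      using \<open>closed S\<close> by (intro compact_continuous_image continuous_on_subset[OF cont]) auto
    moreover have "y \<in> closure (H ` ?S)"
      unfolding closure_approachable
    proof (intro allI impI)
      fix e :: real assume "e > 0"
      \<comment> \<open>Precision at most 1, together with displacement at most \<open>B\<close>,
        puts \<open>z\<close> into the ball of radius \<open>B + 1\<close>.\<close>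
      then obtain z where z: "z \<in> S" "dist (H z) y < min e 1"
        using y unfolding closure_approachable
        by (metis (no_types, lifting) imageE min_less_iff_conj zero_less_one)
      have "dist y z \<le> dist (H z) y + dist (H z) z"
        by (metis dist_commute dist_triangle)
      also have "dist (H z) z \<le> B"
        using B[OF z(1)] by (simp add: dist_norm)
      finally have "z \<in> ?S"
        using z by simp
      then show "\<exists>x\<in>H ` ?S. dist x y < e"
        using z by auto
    qed
    ultimately show ?thesis
      using compact_imp_closed closure_closed by fastforce
  qed
  then show ?thesis
    using closure_subset closure_subset_eq by blast
qed

text \<open>By Kronecker's theorem the integer multiples of \<open>\<rho>\<close>, shifted by
  integer vectors, are dense; hence so is their translate by \<open>x\<close>, which lies in the
  closed set \<open>R\<close>.\<close>

lemma translation_invariant_closed_eq_UNIV: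
  fixes R :: "(real ^ 'n::finite) set"
  assumes "closed R" "x \<in> R" and irr: "totally_irrational \<rho>"
    and fwd: "\<And>y. y \<in> R \<longleftrightarrow> y + \<rho> \<in> R"
    and per: "\<And>y m. y \<in> R \<Longrightarrow> m \<in> integer_vectors \<Longrightarrow> y + m \<in> R"
  shows "R = UNIV"
proof -
  \<comment> \<open>Kronecker's multiplier \<open>k\<close> may be negative, so both directions of
    \<open>fwd\<close> enter.\<close>
  have orbit: "x + of_int k *\<^sub>R \<rho> \<in> R" for k
  proof (induction k rule: int_induct[where k = 0])
    case base
    show ?case using \<open>x \<in> R\<close> by simp
  next
    case (step1 k)
    then show ?case using fwd[of "x + of_int k *\<^sub>R \<rho>"] by (simp add: algebra_simps)
  next
    case (step2 k)
    then show ?case using fwd[of "x + of_int (k - 1) *\<^sub>R \<rho>"] by (simp add: algebra_simps)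
  qed
  have "y \<in> closure R" for y
    unfolding closure_approachable
  proof (intro allI impI)
    fix e :: real assume "e > 0"
    then obtain k :: int and m where "m \<in> integer_vectors" "norm (of_int k *\<^sub>R \<rho> + m - (y - x)) < e"
      using Kronecker_totally_irrational[OF irr] by blast
    then show "\<exists>z\<in>R. dist z y < e"
      using per[OF orbit, of m k]
      by (intro bexI[of _ "x + of_int k *\<^sub>R \<rho> + m"]) (auto simp: dist_norm algebra_simps)
  qed
  then show ?thesis
    using \<open>closed R\<close> by (auto simp: closure_closed)
qed

section \<open>Descent from the cover to the torus\<close>

text \<open>Commuting with integer translations lets \<open>H\<close> descend to a map on
  \<open>K\<close>. Its image on the cover is closed, periodic and invariant under
  \<open>\<rho>\<close> in both directions, hence the whole space, which gives surjectivity on the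
  torus.\<close>

lemma regular_semiconjugacy_of_lift:
  assumes lift: "is_lift F f" and K: "closed K" "K \<noteq> {}" and irr: "totally_irrational \<rho>"
    and FZ: "F ` (torus_proj -` K) = torus_proj -` K"
    and cont: "continuous_on (torus_proj -` K) H"
    and B: "\<And>z. torus_proj z \<in> K \<Longrightarrow> norm (H z - z) \<le> B"
    and HF: "\<And>z. torus_proj z \<in> K \<Longrightarrow> H (F z) = H z + \<rho>"
    and per: "\<And>z k. torus_proj z \<in> K \<Longrightarrow> k \<in> integer_vectors \<Longrightarrow> H (z + k) = H z + k"
  shows "regularly_semiconjugate f K F \<rho>"
proof -
  let ?Z = "torus_proj -` K"
  have pF: "torus_proj (F z) = f (torus_proj z)" for z
    using lift by (auto simp: is_lift_def fun_eq_iff)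
  have Z: "closed ?Z"
    using K by (simp add: closed_torus_iff)
  obtain z0 where z0: "z0 \<in> ?Z"
    using K surj_torus_proj by (metis ex_in_conv vimage_eq)
  have "H ` ?Z = UNIV"
  proof (rule translation_invariant_closed_eq_UNIV[OF _ _ irr])
    show "closed (H ` ?Z)"
      using B by (intro closed_image_bounded_displacement[OF Z cont]) auto
    show "H z0 \<in> H ` ?Z"
      using z0 by simp
    show "y \<in> H ` ?Z \<longleftrightarrow> y + \<rho> \<in> H ` ?Z" for y
    proof
      assume "y \<in> H ` ?Z"
      then obtain z where z: "z \<in> ?Z" "y = H z" by auto
      then have "F z \<in> ?Z" using FZ by blast
      with z HF[of z] show "y + \<rho> \<in> H ` ?Z" by (metis image_eqI vimageD)
    next
      assume "y + \<rho> \<in> H ` ?Z"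
      then obtain w where "w \<in> ?Z" "y + \<rho> = H w" by auto
      moreover obtain z where "z \<in> ?Z" "w = F z"
        using FZ \<open>w \<in> ?Z\<close> by (metis imageE)
      ultimately show "y \<in> H ` ?Z"
        using HF[of z] by auto
    qed
    show "y + m \<in> H ` ?Z" if "y \<in> H ` ?Z" "m \<in> integer_vectors" for y m
      using that per by (auto simp: torus_proj_add_integer intro!: image_eqI[of _ H "_ + m"])
  qed
  \<comment> \<open>The representative is arbitrary: by \<open>per\<close>, another one changes
    \<open>H\<close> by an integer vector, invisible after projection.\<close>
  define h where "h x = torus_proj (H (SOME z. torus_proj z = x))" for x
  have h: "torus_proj (H z) = h (torus_proj z)" if "z \<in> ?Z" for z
  proof -
    define w where "w = (SOME w. torus_proj w = torus_proj z)"
    have w: "torus_proj w = torus_proj z"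
      unfolding w_def by (rule someI) simp
    then have "w - z \<in> integer_vectors"
      by (simp add: torus_proj_eq_iff)
    from per[OF _ this, of z] that this have "torus_proj (H w) = torus_proj (H z)"
      by (simp add: torus_proj_add_integer)
    then show ?thesis by (simp add: h_def w_def)
  qed
  have "continuous_on K h"
    unfolding continuous_on_closed_vimage[OF K(1)]
  proof (intro allI impI)
    fix C :: "'a torus set" assume "closed C"
    then have "closed (H -` (torus_proj -` C) \<inter> ?Z)"
      using cont unfolding continuous_on_closed_vimage[OF Z] by (simp add: closed_torus_iff)
    \<comment> \<open>Closedness on the torus is tested on preimages under the projection, so
      continuity of \<open>h\<close> reduces to that of \<open>H\<close>.\<close>
    also have "H -` (torus_proj -` C) \<inter> ?Z = torus_proj -` (h -` C \<inter> K)"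
      using h by auto
    finally show "closed (h -` C \<inter> K)"
      by (simp add: closed_torus_iff)
  qed
  moreover have "h ` K = UNIV"
  proof -
    have "x \<in> h ` K" for x
    proof -
      obtain y where "torus_proj y = x" using surj_torus_proj by blast
      moreover obtain z where "z \<in> ?Z" "y = H z"
        using \<open>H ` ?Z = UNIV\<close> by (metis UNIV_I imageE)
      ultimately show ?thesis using h by auto
    qed
    then show ?thesis by auto
  qed
  moreover have "h (f x) = rotation \<rho> (h x)" if "x \<in> K" for x
  proof -
    obtain z where z: "torus_proj z = x" using surj_torus_proj by blast
    with that have "z \<in> ?Z" "F z \<in> ?Z" using FZ by auto
    then show ?thesis
      using h[of z] h[of "F z"] HF[of z] z by (metis pF rotation_torus_proj vimageD)
  qed
  ultimately have "semiconjugacy K f UNIV (rotation \<rho>) h"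
    by (simp add: semiconjugacy_def)
  moreover have "bdd_above ((\<lambda>z. norm (H z - z)) ` ?Z)"
    using B by (auto intro!: bdd_aboveI)
  ultimately show ?thesis
    unfolding regularly_semiconjugate_def regular_semiconjugacy_def
    using cont h HF by (intro exI[of _ h] conjI exI[of _ H]) auto
qed

section \<open>Construction of the semi-conjugacy\<close>

theorem propositionA:
  fixes f :: "'n::finite torus \<Rightarrow> 'n torus"
    and K :: "'n torus set"
    and F :: "real ^ 'n \<Rightarrow> real ^ 'n"
    and \<rho> :: "real ^ 'n"
  assumes "\<exists>g. homeomorphism UNIV UNIV f g"
    and "homotopic_with_canon (\<lambda>_. True) UNIV UNIV f id"
    and "minimal_set f K"
    and "irrational_pseudo_rotation_on f K F \<rho>"
    and "bounded_mean_motion_on K F \<rho>"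
  shows "regularly_semiconjugate f K F \<rho>"
proof -
  let ?Z = "torus_proj -` K"
  have K: "K \<noteq> {}" "closed K" "f ` K = K"
    using assms(3) by (auto simp: minimal_set_def invariant_set_def)
  have lift: "is_lift F f" and irr: "totally_irrational \<rho>"
    using assms(4) by (auto simp: irrational_pseudo_rotation_on_def)
  have F: "continuous_on UNIV F"
    using lift by (simp add: is_lift_def)
  have "bij f"
    using assms(1) by (auto simp: homeomorphism_def intro: bij_betw_byWitness)
  obtain c where c: "\<And>n z. torus_proj z \<in> K \<Longrightarrow> norm (iter F n z - z - of_int n *\<^sub>R \<rho>) \<le> c"
    using assms(5) by (auto simp: bounded_mean_motion_on_def)
  \<comment> \<open>The mean motion bound at \<open>n = 1\<close> is the displacement bound for
    \<open>F\<close> itself.\<close>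
  have comm: "F (z + k) = F z + k" if "k \<in> integer_vectors" for z k
    using c[of _ 1] by (intro lift_commutes[OF lift _ K(1) that]) (simp add: iter_def)
  have "bij F"
    using bij_lift[OF lift \<open>bij f\<close> comm] .
  have FZ: "F ` ?Z = ?Z"
    using lift_image_preimage[OF lift \<open>bij f\<close> \<open>bij F\<close> K(3)] .
  have Z: "closed ?Z"
    using K by (simp add: closed_torus_iff)

  define p where "p i n z = (iter F n z - of_int n *\<^sub>R \<rho>) $ i" for i n z
  have p_cont: "continuous_on S (p i n)" for S i n
    unfolding p_def[abs_def]
    by (intro continuous_intros continuous_on_subset[OF continuous_on_iter[OF F \<open>bij F\<close>]]) auto
  have p_F: "p i n (F z) = p i (n + 1) z + \<rho> $ i" for i n z
    by (simp add: p_def iter_shift[OF \<open>bij F\<close>] algebra_simps)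
  have p_per: "p i n (z + k) = p i n z + k $ i" if "k \<in> integer_vectors" for i n z k
    using comm[OF that] by (simp add: p_def iter_add_commutes[OF \<open>bij F\<close>])
  have p_bound: "\<bar>p i n z - z $ i\<bar> \<le> c" if "z \<in> ?Z" for i n z
  proof -
    have "\<bar>(iter F n z - z - of_int n *\<^sub>R \<rho>) $ i\<bar> \<le> c"
      using c[of z n] that component_le_norm_cart order_trans by blast
    then show ?thesis by (simp add: p_def algebra_simps)
  qed
  have p_bdd: "bdd_above (range (\<lambda>n. p i n z))" "bdd_below (range (\<lambda>n. p i n z))" if "z \<in> ?Z" for i z
    using p_bound[OF that] by (auto intro!: bdd_aboveI[of _ "z $ i + c"] bdd_belowI[of _ "z $ i - c"]
        simp: abs_le_iff algebra_simps)

  have osc_le: "p i n z - p i m z \<le> (SUP n. p i n w) - (INF n. p i n w)"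
    if "z \<in> ?Z" and w: "w \<in> ?Z" for i n m z w
  proof -
    let ?t = "(SUP n. p i n w) - (INF n. p i n w)"
    \<comment> \<open>Bounding all pairwise differences by the oscillation at \<open>w\<close> is a
      closed condition. It holds at \<open>w\<close> and is invariant under \<open>F\<close> and
      integer translations, so minimality spreads it over the whole preimage of
      \<open>K\<close>.\<close>
    define L where "L = ?Z \<inter> {z. \<forall>n m. p i n z - p i m z \<le> ?t}"
    have "L = ?Z"
    proof (rule minimal_set_lift[OF assms(3) lift])
      have "p i n w - p i m w \<le> ?t" for n m
        by (intro diff_mono cSUP_upper cINF_lower p_bdd w) auto
      then show "L \<noteq> {}"
        using w by (auto simp: L_def)
      show "closed L"
        unfolding L_def
        by (intro closed_Int Z closed_Collect_all closed_Collect_le continuous_intros p_cont)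
      have "F z \<in> L \<longleftrightarrow> z \<in> L" for z
      proof -
        have "F z \<in> ?Z \<longleftrightarrow> z \<in> ?Z"
          using FZ \<open>bij F\<close> by (metis bij_is_inj inj_image_mem_iff)
        \<comment> \<open>Applying \<open>F\<close> shifts both indices and adds
          \<open>\<rho> $ i\<close> to both terms. The shift permutes the integers and the added
          constants cancel.\<close>
        moreover have "(\<forall>n m. p i (n + 1) z - p i (m + 1) z \<le> ?t) \<longleftrightarrow> (\<forall>n m. p i n z - p i m z \<le> ?t)"
          by (metis diff_add_cancel)
        ultimately show ?thesis by (auto simp: L_def p_F)
      qed
      then show "F ` L = L"
        using \<open>bij F\<close> by (metis (no_types, lifting) bij_is_surj image_subset_iff subsetI
            subset_antisym surj_f_inv_f image_eqI)
    qed (auto simp: L_def p_per torus_proj_add_integer)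
    with \<open>z \<in> ?Z\<close> show ?thesis by (auto simp: L_def)
  qed
  have osc_mono: "(SUP n. p i n z) - (INF n. p i n z) \<le> (SUP n. p i n w) - (INF n. p i n w)"
    if "z \<in> ?Z" "w \<in> ?Z" for i z w
  proof -
    let ?t = "(SUP n. p i n w) - (INF n. p i n w)"
    \<comment> \<open>The pairwise bound passes to the supremum over one index, then to the infimum
      over the other.\<close>
    have "(SUP n. p i n z) - ?t \<le> p i m z" for m
    proof -
      have "(SUP n. p i n z) \<le> p i m z + ?t"
        using osc_le[OF that] by (intro cSUP_least) (auto simp: algebra_simps)
      then show ?thesis by simp
    qed
    then have "(SUP n. p i n z) - ?t \<le> (INF n. p i n z)"
      by (intro cINF_greatest) auto
    then show ?thesis by simp
  qed
  obtain z0 where z0: "z0 \<in> ?Z"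
    using K surj_torus_proj by (metis ex_in_conv vimage_eq)
  have sup_cont: "continuous_on ?Z (\<lambda>z. SUP n. p i n z)" for i
  proof (rule continuous_on_SUP_constant_oscillation[OF p_cont p_bdd])
    fix z assume "z \<in> ?Z"
    \<comment> \<open>Exchanging the two points in \<open>osc_mono\<close> gives equality, so the
      oscillation at the reference point \<open>z0\<close> serves as the constant.\<close>
    then show "(SUP n. p i n z) = ((SUP n. p i n z0) - (INF n. p i n z0)) + (INF n. p i n z)"
      using osc_mono[OF _ z0, of z i] osc_mono[OF z0, of z i] by simp
  qed

  have SUP_add: "(SUP n. p i n z + a) = (SUP n. p i n z) + a" if "z \<in> ?Z" for i z a
  proof (rule antisym)
    show "(SUP n. p i n z + a) \<le> (SUP n. p i n z) + a"
      using p_bdd(1)[OF that] by (intro cSUP_least) (auto intro: cSUP_upper)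
    have bdd: "bdd_above (range (\<lambda>n. p i n z + a))"
      using p_bound[OF that] by (auto intro!: bdd_aboveI[of _ "z $ i + c + a"] simp: abs_le_iff algebra_simps)
    have "p i n z \<le> (SUP n. p i n z + a) - a" for n
      using cSUP_upper[OF UNIV_I bdd, of n] by simp
    then have "(SUP n. p i n z) \<le> (SUP n. p i n z + a) - a"
      by (intro cSUP_least) auto
    then show "(SUP n. p i n z) + a \<le> (SUP n. p i n z + a)" by simp
  qed
  define H where "H z = (\<chi> i. SUP n. p i n z)" for z
  show ?thesis
  proof (rule regular_semiconjugacy_of_lift[OF lift K(2,1) irr FZ])
    show "continuous_on ?Z H"
      unfolding H_def[abs_def] by (intro continuous_on_vec_lambda sup_cont)
  next
    fix z assume "torus_proj z \<in> K"
    then have z: "z \<in> ?Z" by simp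
    have "\<bar>(H z - z) $ i\<bar> \<le> c" for i
    proof -
      have "(SUP n. p i n z) \<le> z $ i + c"
        using p_bound[OF z] by (intro cSUP_least) (auto simp: abs_le_iff algebra_simps)
      \<comment> \<open>A single term bounds the supremum from below; the index 0 is chosen.\<close>
      moreover have "z $ i - c \<le> p i 0 z"
        using p_bound[OF z, of i 0] by linarith
      then have "z $ i - c \<le> (SUP n. p i n z)"
        by (rule order_trans) (auto intro: cSUP_upper p_bdd[OF z])
      ultimately show ?thesis by (simp add: H_def abs_le_iff)
    qed
    then show "norm (H z - z) \<le> (\<Sum>i\<in>(UNIV :: 'n set). c)"
      by (intro order_trans[OF norm_le_l1_cart] sum_mono)
    have "(SUP n. p i (n + 1) z + \<rho> $ i) = (SUP n. p i n z) + \<rho> $ i" for i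
    proof -
      \<comment> \<open>The shift is onto because \<open>n\<close> ranges over all integers; over
        the naturals it would drop the term at 0, and only an inequality would follow.\<close>
      have "range (\<lambda>n. p i (n + 1) z + \<rho> $ i) = range (\<lambda>n. p i n z + \<rho> $ i)"
        by (auto simp: image_iff) (metis diff_add_cancel)
      then show ?thesis using SUP_add[OF z] by simp
    qed
    then show "H (F z) = H z + \<rho>"
      by (simp add: H_def vec_eq_iff p_F)
    show "H (z + k) = H z + k" if "k \<in> integer_vectors" for k
      by (simp add: H_def vec_eq_iff p_per[OF that] SUP_add[OF z])
  qed
qed

end
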